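(* Let $K\in\mathcal{K}^2$ and let $H\subset\mathbb{R}^2$ be a (centrally symmetric) regular hexagon. If $D(K,H)<2R(K,H)$, then \[ r(K,H)\geq \frac{R(K,H)}{4}. \]
   Context: $\mathcal{K}^n$ denotes the set of convex bodies, i.e. (nonempty) convex compact subsets of $\mathbb{R}^n$. For $K,C\in\mathcal{K}^n$, with $C$ full-dimensional (the gauge): the circumradius $R(K,C)$ is the smallest $\lambda\geq 0$ such that a translate of $K$ is contained in $\lambda C$; the inradius $r(K,C)$ is the largest $\lambda\geq 0$ such that a translate of $K$ contains $\lambda C$; the diameter is $D(K,C)=2\max_{x,y\in K}R(\{x,y\},C)$. *)

theory Defs
  imports "HOL-Analysis.Analysis"
begin

definition convex_body :: "'a::euclidean_space set \<Rightarrow> bool" where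
  "convex_body K \<longleftrightarrow> K \<noteq> {} \<and> convex K \<and> compact K"

text \<open>
  The following functionals are meant for nonempty compact \<open>K\<close> and full-dimensional
  convex bodies \<open>C\<close> (the gauge), which need not contain the origin. The lemmas below
  show that the extremal values do exist in that case.
\<close>

definition circumradius :: "'a::euclidean_space set \<Rightarrow> 'a set \<Rightarrow> real" where
  "circumradius K C = (LEAST l. 0 \<le> l \<and> (\<exists>t. (+) t ` K \<subseteq> (*\<^sub>R) l ` C))"

definition inradius :: "'a::euclidean_space set \<Rightarrow> 'a set \<Rightarrow> real" where
  "inradius K C = (GREATEST l. 0 \<le> l \<and> (\<exists>t. (*\<^sub>R) l ` C \<subseteq> (+) t ` K))"

definition gauge_diameter :: "'a::euclidean_space set \<Rightarrow> 'a set \<Rightarrow> real" where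
  "gauge_diameter K C = 2 * (GREATEST d. \<exists>x\<in>K. \<exists>y\<in>K. d = circumradius {x, y} C)"

text \<open>
  A regular hexagon is the convex hull of six equally spaced points on a circle of
  positive radius; centre and orientation are arbitrary. It is centrally symmetric
  about its centre \<open>c\<close>.
\<close>

definition regular_hexagon :: "(real^2) set \<Rightarrow> bool" where
  "regular_hexagon H \<longleftrightarrow>
     (\<exists>(c::real^2) (\<rho>::real) (\<theta>::real). 0 < \<rho> \<and>
        H = convex hull ((\<lambda>k::nat. c + \<rho> *\<^sub>R vector [cos (\<theta> + 2 * pi * real k / 6),
                                                     sin (\<theta> + 2 * pi * real k / 6)]) ` {..<6}))"

lemma circumradius_least:
  fixes K C :: "'a::euclidean_space set"
  assumes K: "compact K" "K \<noteq> {}" and C: "compact C" "interior C \<noteq> {}"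
  shows "0 \<le> circumradius K C" (is ?g1)
    and "\<exists>t. (+) t ` K \<subseteq> (*\<^sub>R) (circumradius K C) ` C" (is ?g2)
    and "0 \<le> l \<Longrightarrow> (+) t ` K \<subseteq> (*\<^sub>R) l ` C \<Longrightarrow> circumradius K C \<le> l"
proof -
  let ?P = "\<lambda>l::real. 0 \<le> l \<and> (\<exists>t. (+) t ` K \<subseteq> (*\<^sub>R) l ` C)"
  obtain c e where e: "e > 0" "cball c e \<subseteq> C"
    using C(2) by (metis ex_in_conv mem_interior_cball)
  obtain M where M: "M > 0" "\<And>x. x \<in> K \<Longrightarrow> norm x \<le> M"
    using compact_imp_bounded[OF K(1)] bounded_pos by blast
  define L where "L = M / e"
  have L: "L > 0" using e M by (simp add: L_def)
  define A where "A = (\<lambda>x. (\<lambda>(l,c). (l, l *\<^sub>R c - x)) ` ({0..L} \<times> C))"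
  have A: "compact (A x)" for x
    unfolding A_def by (intro compact_continuous_image compact_Times compact_Icc C)
      (unfold split_beta, intro continuous_intros)
  have A_iff: "(l,t) \<in> A x \<longleftrightarrow> 0 \<le> l \<and> l \<le> L \<and> t + x \<in> (*\<^sub>R) l ` C" for l t x
    unfolding A_def image_iff by (auto simp: algebra_simps)
  define T where "T = (\<Inter>x\<in>K. A x)"
  have T: "compact T" unfolding T_def
    using A K(2) by (intro compact_Inter) (auto)
  have T_iff: "(l,t) \<in> T \<longleftrightarrow> 0 \<le> l \<and> l \<le> L \<and> (+) t ` K \<subseteq> (*\<^sub>R) l ` C" for l t
    unfolding T_def using A_iff K(2) by auto
  have "(L, L *\<^sub>R c) \<in> T"
    unfolding T_iff
  proof (intro conjI image_subsetI)
    fix x assume "x \<in> K"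
    have "norm (x /\<^sub>R L) \<le> e"
      using M(2)[OF \<open>x \<in> K\<close>] L e M by (simp add: L_def field_simps)
    hence "c + x /\<^sub>R L \<in> C" using e by (auto simp: dist_norm intro!: subsetD[OF e(2)])
    moreover have "L *\<^sub>R c + x = L *\<^sub>R (c + x /\<^sub>R L)" using L by (simp add: scaleR_add_right)
    ultimately show "L *\<^sub>R c + x \<in> (*\<^sub>R) L ` C" by blast
  qed (use L in auto)
  hence "L \<in> fst ` T" by (metis fst_conv imageI)
  hence ne: "fst ` T \<noteq> {}" "L \<in> fst ` T" by auto
  have "compact (fst ` T)" using T by (intro compact_continuous_image continuous_intros)
  then obtain m where m: "m \<in> fst ` T" "\<And>y. y \<in> fst ` T \<Longrightarrow> m \<le> y"
    using compact_attains_inf ne by metis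
  have Pm: "?P m" using m(1) T_iff by force
  have le: "m \<le> l" if l: "?P l" for l
  proof (cases "l \<le> L")
    case True
    obtain t where "(+) t ` K \<subseteq> (*\<^sub>R) l ` C" using l by blast
    hence "(l,t) \<in> T" unfolding T_iff using that True by simp
    hence "l \<in> fst ` T" by (metis fst_conv imageI)
    thus ?thesis by (rule m(2))
  qed (use m(2)[OF ne(2)] in auto)
  have eq: "circumradius K C = m"
    unfolding circumradius_def using Pm le by (intro Least_equality)
  show ?g1 ?g2 using Pm eq by auto
  show "0 \<le> l \<Longrightarrow> (+) t ` K \<subseteq> (*\<^sub>R) l ` C \<Longrightarrow> circumradius K C \<le> l" using le eq by blast
qed

lemma inradius_greatest:
  fixes K C :: "'a::euclidean_space set"
  assumes K: "compact K" "K \<noteq> {}" and C: "compact C" "interior C \<noteq> {}"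
  shows "0 \<le> inradius K C" (is ?g1)
    and "\<exists>t. (*\<^sub>R) (inradius K C) ` C \<subseteq> (+) t ` K" (is ?g2)
    and "0 \<le> l \<Longrightarrow> (*\<^sub>R) l ` C \<subseteq> (+) t ` K \<Longrightarrow> l \<le> inradius K C"
proof -
  let ?P = "\<lambda>l::real. 0 \<le> l \<and> (\<exists>t. (*\<^sub>R) l ` C \<subseteq> (+) t ` K)"
  obtain c e where e: "e > 0" "cball c e \<subseteq> C"
    using C(2) by (metis ex_in_conv mem_interior_cball)
  obtain b :: 'a where b: "b \<in> Basis" using nonempty_Basis by blast
  define c' where "c' = c + e *\<^sub>R b"
  have c: "c \<in> C" "c' \<in> C" and cc: "norm (c' - c) = e"
    using e b by (auto simp: c'_def dist_norm intro!: subsetD[OF e(2)])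
  define L where "L = diameter K / e"
  have L: "L \<ge> 0" using e K by (simp add: L_def diameter_ge_0 compact_imp_bounded)
  have bnd: "l \<le> L" if l: "0 \<le> l" "(*\<^sub>R) l ` C \<subseteq> (+) t ` K" for l t
  proof -
    obtain x y where xy: "x \<in> K" "y \<in> K" "l *\<^sub>R c = t + x" "l *\<^sub>R c' = t + y"
      using l(2) c by (metis (no_types, lifting) image_iff image_subset_iff)
    have "l *\<^sub>R (c' - c) = y - x" using xy by (simp add: algebra_simps)
    hence "l * e = norm (y - x)" using cc that(1) by (metis norm_scaleR abs_of_nonneg)
    also have "\<dots> \<le> diameter K"
      using diameter_bounded_bound[OF compact_imp_bounded[OF K(1)] xy(2) xy(1)]
      by (simp add: dist_norm)
    finally show ?thesis using e by (simp add: L_def field_simps)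
  qed
  define A where "A = (\<lambda>c. (\<lambda>(l,x). (l, l *\<^sub>R c - x)) ` ({0..L} \<times> K))"
  have A: "compact (A x)" for x
    unfolding A_def by (intro compact_continuous_image compact_Times compact_Icc K)
      (unfold split_beta, intro continuous_intros)
  have A_iff: "(l,t) \<in> A c \<longleftrightarrow> 0 \<le> l \<and> l \<le> L \<and> l *\<^sub>R c \<in> (+) t ` K" for l t c
    unfolding A_def image_iff by (auto simp: algebra_simps) (metis add.commute)
  define T where "T = (\<Inter>c\<in>C. A c)"
  have T: "compact T" unfolding T_def
    using A c by (intro compact_Inter) (auto)
  have T_iff: "(l,t) \<in> T \<longleftrightarrow> 0 \<le> l \<and> l \<le> L \<and> (*\<^sub>R) l ` C \<subseteq> (+) t ` K" for l t
    unfolding T_def using A_iff c by auto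
  obtain x where x: "x \<in> K" using K by blast
  have "(0, - x) \<in> T"
    unfolding T_iff using x L by (auto simp: image_iff intro!: bexI[of _ x])
  hence ne: "fst ` T \<noteq> {}" by force
  have "compact (fst ` T)" using T by (intro compact_continuous_image continuous_intros)
  then obtain m where m: "m \<in> fst ` T" "\<And>y. y \<in> fst ` T \<Longrightarrow> y \<le> m"
    using compact_attains_sup ne by metis
  have Pm: "?P m" using m(1) T_iff by force
  have le: "l \<le> m" if l: "?P l" for l
  proof -
    obtain t where "(*\<^sub>R) l ` C \<subseteq> (+) t ` K" using l by blast
    hence "(l,t) \<in> T" unfolding T_iff using that bnd by simp
    hence "l \<in> fst ` T" by (metis fst_conv imageI)
    thus ?thesis by (rule m(2))
  qed
  have eq: "inradius K C = m"
    unfolding inradius_def using Pm le by (intro Greatest_equality)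
  show ?g1 ?g2 using Pm eq by auto
  show "0 \<le> l \<Longrightarrow> (*\<^sub>R) l ` C \<subseteq> (+) t ` K \<Longrightarrow> l \<le> inradius K C" using le eq by blast
qed

lemma gauge_diameter_greatest:
  fixes K C :: "'a::euclidean_space set"
  assumes K: "compact K" "K \<noteq> {}" and C: "convex C" "compact C" "interior C \<noteq> {}"
  shows "\<exists>x\<in>K. \<exists>y\<in>K. gauge_diameter K C = 2 * circumradius {x, y} C" (is ?g1)
    and "x \<in> K \<Longrightarrow> y \<in> K \<Longrightarrow> 2 * circumradius {x, y} C \<le> gauge_diameter K C"
proof -
  define f where "f = (\<lambda>p::'a \<times> 'a. circumradius {fst p, snd p} C)"
  obtain c e where e: "e > 0" "cball c e \<subseteq> C"
    using C(3) by (metis ex_in_conv mem_interior_cball)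
  have lip: "f p \<le> f q + dist p q / e" for p q
  proof (cases "p = q")
    case False
    define l where "l = f q"
    define m where "m = dist p q / e"
    have m: "m > 0" using False e by (simp add: m_def)
    have l: "l \<ge> 0" unfolding l_def f_def using C by (intro circumradius_least) auto
    have "\<exists>t. (+) t ` {fst q, snd q} \<subseteq> (*\<^sub>R) l ` C"
      unfolding l_def f_def using C by (intro circumradius_least) auto
    then obtain t where t: "t + fst q \<in> (*\<^sub>R) l ` C" "t + snd q \<in> (*\<^sub>R) l ` C" by auto
    have step: "(t + m *\<^sub>R c) + x \<in> (*\<^sub>R) (l + m) ` C"
      if ty: "t + y \<in> (*\<^sub>R) l ` C" and "norm (x - y) \<le> dist p q" for x y
    proof -
      obtain a where a: "a \<in> C" "t + y = l *\<^sub>R a" using ty by blast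
      have "norm ((x - y) /\<^sub>R m) \<le> e"
        using that(2) m e False
        by (simp only: norm_scaleR) (simp add: m_def field_simps)
      hence b: "c + (x - y) /\<^sub>R m \<in> C" (is "?b \<in> C")
        using e by (auto simp: dist_norm intro!: subsetD[OF e(2)])
      have "(l / (l + m)) *\<^sub>R a + (m / (l + m)) *\<^sub>R ?b \<in> C" (is "?d \<in> C")
        using l m a b by (intro convexD[OF C(1)]) (auto simp: add_divide_distrib[symmetric])
      moreover have "(t + m *\<^sub>R c) + x = l *\<^sub>R a + m *\<^sub>R ?b"
        using m by (simp add: a(2)[symmetric] scaleR_add_right)
      moreover have "\<dots> = (l + m) *\<^sub>R ?d"
        using l m by (simp only: scaleR_add_right[of "l + m"] scaleR_scaleR) simp
      ultimately show ?thesis by auto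
    qed
    have "norm (fst p - fst q) \<le> dist p q" "norm (snd p - snd q) \<le> dist p q"
      using dist_fst_le dist_snd_le by (metis dist_norm)+
    hence "(+) (t + m *\<^sub>R c) ` {fst p, snd p} \<subseteq> (*\<^sub>R) (l + m) ` C"
      using step t by blast
    hence "f p \<le> l + m" unfolding f_def using l m C
      by (intro circumradius_least(3)) auto
    thus ?thesis by (simp add: l_def m_def)
  qed simp
  have "(1 / e)-lipschitz_on (K \<times> K) f"
  proof (rule lipschitz_onI)
    fix p q
    show "dist (f p) (f q) \<le> 1 / e * dist p q"
      using lip[of p q] lip[of q p] by (simp add: dist_real_def dist_commute abs_le_iff)
  qed (use e in auto)
  hence "continuous_on (K \<times> K) f" by (rule lipschitz_on_continuous_on)
  moreover have "compact (K \<times> K)" "K \<times> K \<noteq> {}" using K by (auto intro: compact_Times)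
  ultimately obtain p where p: "p \<in> K \<times> K" "\<And>q. q \<in> K \<times> K \<Longrightarrow> f q \<le> f p"
    using continuous_attains_sup by metis
  have "(GREATEST d. \<exists>x\<in>K. \<exists>y\<in>K. d = circumradius {x, y} C) = f p"
  proof (rule Greatest_equality)
    show "\<exists>x\<in>K. \<exists>y\<in>K. f p = circumradius {x, y} C" using p(1) unfolding f_def by force
    show "d \<le> f p" if "\<exists>x\<in>K. \<exists>y\<in>K. d = circumradius {x, y} C" for d
      using that p(2) unfolding f_def by force
  qed
  hence eq: "gauge_diameter K C = 2 * f p" by (simp add: gauge_diameter_def)
  show ?g1 using p(1) unfolding eq f_def by force
  show "x \<in> K \<Longrightarrow> y \<in> K \<Longrightarrow> 2 * circumradius {x, y} C \<le> gauge_diameter K C"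
    using p(2)[of "(x,y)"] unfolding eq by (simp add: f_def)
qed

end

theory Submission
  imports Defs
begin

text \<open>
  A regular hexagon is described by three linear functionals \<open>f1\<close>, \<open>f2\<close>, \<open>f3\<close> with sum zero:
  up to translation, it is the set of all points at which they have absolute value at most 1.
  Let \<open>M\<^sub>i\<close> and \<open>m\<^sub>i\<close> be the maximum and the minimum of \<open>f\<^sub>i\<close> on \<open>K\<close>. A translation moves the
  three coordinate ranges of \<open>K\<close> by amounts of sum zero, and nothing else restricts these
  amounts. Hence a translate of \<open>K\<close> fits into the \<open>l\<close>-fold hexagon as soon as
  \<open>M\<^sub>i - m\<^sub>i \<le> 2 l\<close> for all \<open>i\<close>, \<open>M\<^sub>1 + M\<^sub>2 + M\<^sub>3 \<le> 3 l\<close> and \<open>- m\<^sub>1 - m\<^sub>2 - m\<^sub>3 \<le> 3 l\<close>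
  (\<open>circumradius_le\<close>). The widths \<open>M\<^sub>i - m\<^sub>i\<close> are at most the diameter
  (\<open>coordinate_width_le_diameter\<close>). So if \<open>D < 2 R\<close>, then \<open>S \<ge> R\<close> for \<open>S = (M\<^sub>1 + M\<^sub>2 + M\<^sub>3) / 3\<close>
  or for \<open>S = - (m\<^sub>1 + m\<^sub>2 + m\<^sub>3) / 3\<close>. Replacing each \<open>f\<^sub>i\<close> by its negative exchanges the two
  cases, so consider the first.

  Choose \<open>p\<^sub>i \<in> K\<close> with \<open>f\<^sub>i p\<^sub>i = M\<^sub>i\<close>. After a translation, \<open>p\<^sub>1\<close>, \<open>p\<^sub>2\<close>, \<open>p\<^sub>3\<close> lie on three
  alternate edges of the \<open>S\<close>-fold hexagon. The triangle \<open>p\<^sub>1 p\<^sub>2 p\<^sub>3\<close> is large: in the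
  coordinates \<open>(f1, f2)\<close>, twice its area is at least \<open>2 S\<^sup>2\<close> (\<open>touching_triangle_area_ge\<close>).
  Its edges \<open>e\<close> are short: \<open>\<bar>f\<^sub>i e\<bar> \<le> 2 S\<close>, so the determinant of \<open>e\<close> with any vector of the centred
  hexagon is at most \<open>2 S\<close> (\<open>hexagon_determinant_le\<close>). These determinants, divided by twice the area,
  are the changes of the barycentric coordinates under a displacement by that vector. A
  displacement from the centroid by \<open>S / 3\<close> times such a vector therefore changes each
  barycentric coordinate by at most \<open>(S / 3) (2 S) / (2 S\<^sup>2) = 1 / 3\<close> and stays in the triangle
  (\<open>touching_triangle_inradius_ge\<close>). This gives \<open>r \<ge> S / 3 \<ge> R / 3\<close>, which is more than claimed.
\<close>

section \<open>Hexagons in balanced coordinates\<close>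

text \<open>
  Three coordinates with sum zero, of which any two determine a point of the plane, keep the
  threefold symmetry of the hexagon visible; its edges lie on the lines where a coordinate,
  taken relative to the centre \<open>c\<close>, is \<open>1\<close> or \<open>- 1\<close>.
\<close>

locale hexagonal_gauge =
  fixes f1 f2 f3 :: "'a::euclidean_space \<Rightarrow> real" and c :: 'a and H :: "'a set"
  assumes linear: "linear f1" "linear f2" "linear f3"
    and balanced: "f1 x + f2 x + f3 x = 0"
    and coords_inject: "f1 x = f1 y \<Longrightarrow> f2 x = f2 y \<Longrightarrow> x = y"
    and coords_surject: "\<exists>x. f1 x = s \<and> f2 x = t"
    and body: "convex_body H"
    and mem_iff: "x \<in> H \<longleftrightarrow> \<bar>f1 (x - c)\<bar> \<le> 1 \<and> \<bar>f2 (x - c)\<bar> \<le> 1 \<and> \<bar>f3 (x - c)\<bar> \<le> 1"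
begin

lemmas linear_rules =
  linear[THEN linear_add] linear[THEN linear_diff] linear[THEN linear_scale]

lemma f3_eq: "f3 x = - f1 x - f2 x"
  using balanced[of x] by linarith

lemma interior_nonempty: "interior H \<noteq> {}"
proof -
  let ?S = "{x. \<bar>f1 (x - c)\<bar> < 1 \<and> \<bar>f2 (x - c)\<bar> < 1 \<and> \<bar>f3 (x - c)\<bar> < 1}"
  have cont: "continuous_on UNIV (\<lambda>x. f (x - c))" if "linear f" for f :: "'a \<Rightarrow> real"
    using linear_continuous_on_compose[of UNIV "\<lambda>x. x - c" f] that
    by (simp add: continuous_on_diff)
  have "open ?S"
    by (intro open_Collect_conj open_Collect_less continuous_intros cont linear)
  moreover have "?S \<subseteq> H" by (auto simp: mem_iff)
  moreover have "c \<in> ?S" using linear by (simp add: linear_0)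
  ultimately show ?thesis using interior_maximal[of ?S H] by blast
qed

lemma mem_scaled_iff:
  assumes "l > 0"
  shows "l *\<^sub>R c + x \<in> (*\<^sub>R) l ` H \<longleftrightarrow> \<bar>f1 x\<bar> \<le> l \<and> \<bar>f2 x\<bar> \<le> l \<and> \<bar>f3 x\<bar> \<le> l"
proof -
  have "l *\<^sub>R c + x \<in> (*\<^sub>R) l ` H \<longleftrightarrow> c + x /\<^sub>R l \<in> H"
  proof -
    have "l *\<^sub>R c + x = l *\<^sub>R (c + x /\<^sub>R l)" using assms by (simp add: scaleR_add_right)
    thus ?thesis using assms by (simp add: image_iff)
  qed
  thus ?thesis using assms by (simp add: mem_iff linear_rules abs_mult field_simps)
qed

text \<open>
  A translate of \<open>K\<close> fits into the \<open>l\<close>-fold hexagon if there are shifts \<open>t\<^sub>i\<close> of sum zero in the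
  intervals \<open>[- l - m\<^sub>i, l - M\<^sub>i]\<close>. The bounds on the widths make these intervals nonempty, the
  last two hypotheses put zero between the sum of the lower and the sum of the upper endpoints.
\<close>

lemma circumradius_le:
  assumes K: "compact K" "K \<noteq> {}" and l: "l > 0"
    and bounds: "\<And>x. x \<in> K \<Longrightarrow> m1 \<le> f1 x \<and> f1 x \<le> M1"
      "\<And>x. x \<in> K \<Longrightarrow> m2 \<le> f2 x \<and> f2 x \<le> M2"
      "\<And>x. x \<in> K \<Longrightarrow> m3 \<le> f3 x \<and> f3 x \<le> M3"
    and width: "M1 - m1 \<le> 2 * l" "M2 - m2 \<le> 2 * l" "M3 - m3 \<le> 2 * l"
    and upper: "M1 + M2 + M3 \<le> 3 * l" and lower: "- (3 * l) \<le> m1 + m2 + m3"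
  shows "circumradius K H \<le> l"
proof -
  \<comment> \<open>\<open>T\<close> is the least admissible sum of the first two shifts, so that the third is \<open>- T\<close>.\<close>
  define T where "T = max (- l - m1 - l - m2) (M3 - l)"
  define t1 where "t1 = max (- l - m1) (T - (l - M2))"
  define t2 where "t2 = T - t1"
  have t: "- l - m1 \<le> t1" "t1 \<le> l - M1" "- l - m2 \<le> t2" "t2 \<le> l - M2"
    "- l - m3 \<le> - t1 - t2" "- t1 - t2 \<le> l - M3"
    using width upper lower by (auto simp: t2_def t1_def T_def)
  obtain s where s: "f1 s = t1" "f2 s = t2" using coords_surject by blast
  have "l *\<^sub>R c + s + x \<in> (*\<^sub>R) l ` H" if "x \<in> K" for x
  proof -
    have "l *\<^sub>R c + (s + x) \<in> (*\<^sub>R) l ` H"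
      unfolding mem_scaled_iff[OF l] using bounds[OF that] t s f3_eq[of s]
      by (simp add: linear_rules abs_le_iff)
    thus ?thesis by (simp add: add.assoc)
  qed
  thus ?thesis using K l body interior_nonempty
    by (intro circumradius_least(3)[where t = "l *\<^sub>R c + s"]) (auto simp: convex_body_def)
qed

lemma coordinate_width_le_diameter:
  assumes K: "compact K" and xy: "x \<in> K" "y \<in> K"
  shows "f1 x - f1 y \<le> gauge_diameter K H" "f2 x - f2 y \<le> gauge_diameter K H"
    "f3 x - f3 y \<le> gauge_diameter K H"
proof -
  define l where "l = circumradius {x, y} H"
  have H: "convex H" "compact H" using body by (auto simp: convex_body_def)
  have l: "0 \<le> l" "\<exists>t. (+) t ` {x, y} \<subseteq> (*\<^sub>R) l ` H"
    unfolding l_def using H interior_nonempty by (intro circumradius_least; simp)+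
  then obtain t a b where ab: "a \<in> H" "b \<in> H" "t + x = l *\<^sub>R a" "t + y = l *\<^sub>R b" by auto
  have eq: "x - y = l *\<^sub>R ((a - c) - (b - c))"
  proof -
    have "x - y = (t + x) - (t + y)" by simp
    thus ?thesis unfolding ab by (simp add: scaleR_diff_right)
  qed
  have step: "f x - f y \<le> 2 * l"
    if "linear f" "\<bar>f (a - c)\<bar> \<le> 1" "\<bar>f (b - c)\<bar> \<le> 1" for f :: "'a \<Rightarrow> real"
  proof -
    have "f x - f y = l * (f (a - c) - f (b - c))"
      using that(1) eq by (metis linear_diff linear_scale real_scaleR_def)
    also have "\<dots> \<le> l * 2" using l(1) that by (intro mult_left_mono) auto
    finally show ?thesis by simp
  qed
  have "2 * l \<le> gauge_diameter K H"
    unfolding l_def using K xy H interior_nonempty by (intro gauge_diameter_greatest(2)) auto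
  thus "f1 x - f1 y \<le> gauge_diameter K H" "f2 x - f2 y \<le> gauge_diameter K H"
    "f3 x - f3 y \<le> gauge_diameter K H"
    using step[OF linear(1)] step[OF linear(2)] step[OF linear(3)] ab(1,2)
    by (auto simp: mem_iff)
qed

text \<open>
  The hexagon is symmetric about its centre. With the opposite coordinates, every statement on
  the maxima of the coordinates becomes one on their minima.
\<close>

lemma opposite: "hexagonal_gauge (\<lambda>x. - f1 x) (\<lambda>x. - f2 x) (\<lambda>x. - f3 x) c H"
proof
  show "\<exists>x. - f1 x = s \<and> - f2 x = t" for s t
    using coords_surject[of "- s" "- t"] by (metis add.inverse_inverse)
  show "- f1 x + - f2 x + - f3 x = 0" for x using balanced[of x] by linarith
qed (auto simp: linear_rules body mem_iff intro: coords_inject linearI)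

end

section \<open>The inscribed triangle\<close>

lemma convex_combination_3:
  assumes C: "convex C" and "x \<in> C" "y \<in> C" "z \<in> C"
    and "0 \<le> a" "0 \<le> b" "0 \<le> c" "a + b + c = 1"
  shows "a *\<^sub>R x + b *\<^sub>R y + c *\<^sub>R z \<in> C"
  using assms hull_minimal[of "{x, y, z}" C convex] by (auto simp: convex_hull_3)

text \<open>
  The diagonals cut the hexagon into six triangles at its centre, which is the midpoint of two
  opposite vertices. The signs of \<open>a\<close>, \<open>b\<close> and \<open>a + b\<close> tell in which of them a point lies.
\<close>

lemma hexagon_subset_convex:
  fixes u v c :: "'a::real_vector"
  assumes C: "convex C"
    and vertices: "c + u \<in> C" "c - u \<in> C" "c + v \<in> C" "c - v \<in> C" "c + (u - v) \<in> C" "c - (u - v) \<in> C"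
    and ab: "\<bar>a\<bar> \<le> 1" "\<bar>b\<bar> \<le> 1" "\<bar>a + b\<bar> \<le> 1"
  shows "c + (a *\<^sub>R u + b *\<^sub>R v) \<in> C"
proof -
  have "(1/2) *\<^sub>R (c + u) + (1/2) *\<^sub>R (c - u) \<in> C"
    using vertices(1,2) by (intro convexD[OF C]) auto
  hence c: "c \<in> C" by (simp add: scaleR_add_right scaleR_diff_right flip: scaleR_add_left)
  have sector: "c + (\<alpha> *\<^sub>R x + \<beta> *\<^sub>R y) \<in> C"
    if "c + x \<in> C" "c + y \<in> C" "0 \<le> \<alpha>" "0 \<le> \<beta>" "\<alpha> + \<beta> \<le> 1" for x y \<alpha> \<beta>
  proof -
    have "\<alpha> *\<^sub>R (c + x) + \<beta> *\<^sub>R (c + y) + (1 - \<alpha> - \<beta>) *\<^sub>R c \<in> C"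
      using that c by (intro convex_combination_3[OF C]) auto
    thus ?thesis by (simp add: algebra_simps)
  qed
  consider "0 \<le> a" "0 \<le> b" | "a \<le> 0" "b \<le> 0" | "0 \<le> a" "b \<le> 0" "0 \<le> a + b"
    | "0 \<le> a" "b \<le> 0" "a + b \<le> 0" | "a \<le> 0" "0 \<le> b" "0 \<le> a + b" | "a \<le> 0" "0 \<le> b" "a + b \<le> 0"
    by linarith
  thus ?thesis
  proof cases
    case 1 thus ?thesis using sector[of u v a b] vertices ab by simp
  next
    case 2 thus ?thesis using sector[of "- u" "- v" "- a" "- b"] vertices ab by simp
  next
    case 3 thus ?thesis using sector[of u "u - v" "a + b" "- b"] vertices ab
      by (simp add: algebra_simps)
  next
    case 4 thus ?thesis using sector[of "- v" "u - v" "- (a + b)" a] vertices ab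
      by (simp add: algebra_simps)
  next
    case 5 thus ?thesis using sector[of v "- (u - v)" "a + b" "- a"] vertices ab
      by (simp add: algebra_simps)
  next
    case 6 thus ?thesis using sector[of "- u" "- (u - v)" "- (a + b)" b] vertices ab
      by (simp add: algebra_simps)
  qed
qed

text \<open>
  At the vertices of the hexagon the determinant is one of \<open>a'\<close>, \<open>b'\<close>, \<open>a' + b'\<close> up to sign, and a
  linear function that maps the vertices into an interval maps the whole hexagon into it.
\<close>

lemma hexagon_determinant_le:
  fixes a b a' b' r :: real
  assumes ab: "\<bar>a\<bar> \<le> 1" "\<bar>b\<bar> \<le> 1" "\<bar>a + b\<bar> \<le> 1"
    and ab': "\<bar>a'\<bar> \<le> r" "\<bar>b'\<bar> \<le> r" "\<bar>a' + b'\<bar> \<le> r"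
  shows "\<bar>a * b' - b * a'\<bar> \<le> r"
  using hexagon_subset_convex[of "{- r..r}" 0 b' "- a'" a b] ab ab'
  by (simp add: abs_le_iff)

text \<open>
  Let \<open>(S, - \<alpha>, \<alpha> - S)\<close>, \<open>(\<beta> - S, S, - \<beta>)\<close>, \<open>(- \<gamma>, \<gamma> - S, S)\<close> be the balanced coordinates of a
  point on each of three alternate edges of the \<open>S\<close>-fold hexagon. Twice the area of the triangle
  that they span, measured in two of the coordinates, is the left-hand side. It is affine in each
  variable separately, so it is least when every point is an endpoint of its edge, where its values
  are \<open>3 S\<^sup>2\<close> and \<open>2 S\<^sup>2\<close>.
\<close>

lemma touching_triangle_area_ge:
  fixes S \<alpha> \<beta> \<gamma> :: real
  assumes "S > 0" "0 \<le> \<alpha>" "\<alpha> \<le> S" "0 \<le> \<beta>" "\<beta> \<le> S" "0 \<le> \<gamma>" "\<gamma> \<le> S"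
  shows "3 * S\<^sup>2 - S * (\<alpha> + \<beta> + \<gamma>) + (\<alpha> * \<beta> + \<beta> * \<gamma> + \<gamma> * \<alpha>) \<ge> 2 * S\<^sup>2"
proof -
  have "0 \<le> (S - \<alpha>) * (S - \<beta>) * (S - \<gamma>) + \<alpha> * \<beta> * \<gamma>"
    using assms by simp
  also have "\<dots> = S * (S\<^sup>2 - S * (\<alpha> + \<beta> + \<gamma>) + (\<alpha> * \<beta> + \<beta> * \<gamma> + \<gamma> * \<alpha>))"
    by (simp add: algebra_simps power2_eq_square)
  finally show ?thesis using assms(1) by (simp add: zero_le_mult_iff)
qed

context hexagonal_gauge
begin

text \<open>
  Since the coordinates have sum zero, the translation by \<open>S - f1 p1\<close>, \<open>S - f2 p2\<close>, \<open>S - f3 p3\<close> in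
  the three coordinates exists; it puts \<open>p1\<close>, \<open>p2\<close>, \<open>p3\<close> on three alternate edges of the \<open>S\<close>-fold
  hexagon. The proof only uses differences of coordinates and leaves this translation implicit.
\<close>

lemma touching_triangle_inradius_ge:
  assumes K: "convex_body K" and S: "S > 0"
    and p: "p1 \<in> K" "p2 \<in> K" "p3 \<in> K"
    and max: "f1 p1 + f2 p2 + f3 p3 = 3 * S"
    and width: "\<And>x y. x \<in> K \<Longrightarrow> y \<in> K \<Longrightarrow>
        \<bar>f1 x - f1 y\<bar> \<le> 2 * S \<and> \<bar>f2 x - f2 y\<bar> \<le> 2 * S \<and> \<bar>f3 x - f3 y\<bar> \<le> 2 * S"
  shows "S / 3 \<le> inradius K H"
proof -
  \<comment> \<open>The positions of the three points on their edges, as in \<open>touching_triangle_area_ge\<close>.\<close>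
  define \<alpha> where "\<alpha> = f2 p2 - f2 p1 - S"
  define \<beta> where "\<beta> = f3 p3 - f3 p2 - S"
  define \<gamma> where "\<gamma> = f1 p1 - f1 p3 - S"
  define \<Delta> where "\<Delta> = (f1 p2 - f1 p1) * (f2 p3 - f2 p1) - (f2 p2 - f2 p1) * (f1 p3 - f1 p1)"
  have \<Delta>: "\<Delta> \<ge> 2 * S\<^sup>2"
  proof -
    have d: "f1 p2 - f1 p1 = \<beta> - 2 * S" "f2 p3 - f2 p1 = \<gamma> + \<alpha> - S"
      "f2 p2 - f2 p1 = \<alpha> + S" "f1 p3 - f1 p1 = - \<gamma> - S"
      using max balanced[of p1] balanced[of p2] balanced[of p3]
      unfolding \<alpha>_def \<beta>_def \<gamma>_def by linarith+
    have "\<Delta> = 3 * S\<^sup>2 - S * (\<alpha> + \<beta> + \<gamma>) + (\<alpha> * \<beta> + \<beta> * \<gamma> + \<gamma> * \<alpha>)"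
      unfolding \<Delta>_def d by (simp add: algebra_simps power2_eq_square)
    moreover have "0 \<le> \<alpha>" "\<alpha> \<le> S" "0 \<le> \<beta>" "\<beta> \<le> S" "0 \<le> \<gamma>" "\<gamma> \<le> S"
      using width[OF p(1,2), unfolded abs_le_iff] width[OF p(2,3), unfolded abs_le_iff]
        width[OF p(3,1), unfolded abs_le_iff] max
        balanced[of p1] balanced[of p2] balanced[of p3]
      unfolding \<alpha>_def \<beta>_def \<gamma>_def by linarith+
    ultimately show ?thesis using touching_triangle_area_ge[OF S] by simp
  qed
  hence \<Delta>_pos: "\<Delta> > 0" using S by (smt (verit) zero_less_power)
  define q where "q = (1/3) *\<^sub>R (p1 + p2 + p3)"
  have mem: "q + (S / 3) *\<^sub>R (x - c) \<in> K" if x: "x \<in> H" for x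
  proof -
    define a where "a = f1 (x - c)"
    define b where "b = f2 (x - c)"
    have ab: "\<bar>a\<bar> \<le> 1" "\<bar>b\<bar> \<le> 1" "\<bar>a + b\<bar> \<le> 1"
      using x f3_eq[of "x - c"] unfolding mem_iff a_def b_def by auto
    define d where "d = (\<lambda>y z. a * (f2 y - f2 z) - b * (f1 y - f1 z))"
    \<comment> \<open>The barycentric coordinate of the displaced centroid at each vertex: the index pair of
      \<open>w\<close> is the opposite edge.\<close>
    define w where "w = (\<lambda>y z. 1 / 3 + S / (3 * \<Delta>) * d y z)"
    have w: "0 \<le> w y z" if "y \<in> K" "z \<in> K" for y z
    proof -
      have "\<bar>d y z\<bar> \<le> 2 * S"
        unfolding d_def using width[OF that] f3_eq[of y] f3_eq[of z]
        by (intro hexagon_determinant_le ab) (auto simp: abs_le_iff)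
      hence "\<bar>S * d y z\<bar> \<le> S * (2 * S)" using S by (simp add: abs_mult)
      hence "- \<Delta> \<le> S * d y z" using \<Delta> by (simp add: power2_eq_square abs_le_iff)
      thus ?thesis using \<Delta>_pos by (simp add: w_def field_simps)
    qed
    have "w p2 p3 + w p3 p1 + w p1 p2 = 1 + S / (3 * \<Delta>) * (d p2 p3 + d p3 p1 + d p1 p2)"
      by (simp add: w_def algebra_simps add_divide_distrib)
    moreover have "d p2 p3 + d p3 p1 + d p1 p2 = 0" by (simp add: d_def algebra_simps)
    ultimately have sum: "w p2 p3 + w p3 p1 + w p1 p2 = 1" by simp
    have "w p2 p3 *\<^sub>R p1 + w p3 p1 *\<^sub>R p2 + w p1 p2 *\<^sub>R p3 \<in> K"
      using K p w sum by (intro convex_combination_3) (auto simp: convex_body_def)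
    also have "w p2 p3 *\<^sub>R p1 + w p3 p1 *\<^sub>R p2 + w p1 p2 *\<^sub>R p3 = q + (S / 3) *\<^sub>R (x - c)"
    proof -
      \<comment> \<open>Cramer's rule in the two coordinates \<open>f1\<close> and \<open>f2\<close>, which determine the point.\<close>
      have combine: "w p2 p3 * y1 + w p3 p1 * y2 + w p1 p2 * y3
          = (y1 + y2 + y3) / 3 + S / 3 * e"
        if "d p2 p3 * y1 + d p3 p1 * y2 + d p1 p2 * y3 = \<Delta> * e" for y1 y2 y3 e
      proof -
        have "w p2 p3 * y1 + w p3 p1 * y2 + w p1 p2 * y3
            = (y1 + y2 + y3) / 3 + S / (3 * \<Delta>) * (d p2 p3 * y1 + d p3 p1 * y2 + d p1 p2 * y3)"
          by (simp add: w_def algebra_simps add_divide_distrib)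
        thus ?thesis unfolding that using \<Delta>_pos by simp
      qed
      have "f1 (x - c) = a" "f2 (x - c) = b" by (simp_all add: a_def b_def)
      moreover have "d p2 p3 * f1 p1 + d p3 p1 * f1 p2 + d p1 p2 * f1 p3 = \<Delta> * a"
        by (simp add: d_def \<Delta>_def algebra_simps)
      moreover have "d p2 p3 * f2 p1 + d p3 p1 * f2 p2 + d p1 p2 * f2 p3 = \<Delta> * b"
        by (simp add: d_def \<Delta>_def algebra_simps)
      ultimately show ?thesis
        using combine by (intro coords_inject)
          (simp_all add: q_def linear[THEN linear_add] linear[THEN linear_scale])
    qed
    finally show ?thesis .
  qed
  have "(*\<^sub>R) (S / 3) ` H \<subseteq> (+) ((S / 3) *\<^sub>R c - q) ` K"
  proof
    fix z assume "z \<in> (*\<^sub>R) (S / 3) ` H"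
    then obtain x where x: "x \<in> H" "z = (S / 3) *\<^sub>R x" by blast
    have "z = ((S / 3) *\<^sub>R c - q) + (q + (S / 3) *\<^sub>R (x - c))"
      by (simp add: x(2) scaleR_diff_right)
    thus "z \<in> (+) ((S / 3) *\<^sub>R c - q) ` K" using mem[OF x(1)] by blast
  qed
  thus ?thesis using K body S interior_nonempty
    by (intro inradius_greatest(3)) (auto simp: convex_body_def)
qed

lemma inradius_ge_third_maxima:
  assumes K: "convex_body K" and S: "S > 0" "gauge_diameter K H \<le> 2 * S"
    and p: "p1 \<in> K" "p2 \<in> K" "p3 \<in> K"
    and max: "f1 p1 + f2 p2 + f3 p3 = 3 * S"
  shows "S / 3 \<le> inradius K H"
proof (rule touching_triangle_inradius_ge[OF K S(1) p max])
  fix x y assume "x \<in> K" "y \<in> K"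
  moreover have "compact K" using K by (simp add: convex_body_def)
  ultimately show "\<bar>f1 x - f1 y\<bar> \<le> 2 * S \<and> \<bar>f2 x - f2 y\<bar> \<le> 2 * S \<and> \<bar>f3 x - f3 y\<bar> \<le> 2 * S"
    using coordinate_width_le_diameter[of K x y] coordinate_width_le_diameter[of K y x] S(2)
    by (auto simp: abs_le_iff)
qed

text \<open>
  If both coordinate sums \<open>S\<close>, \<open>S'\<close> were less than the circumradius, then so would be some \<open>l\<close>
  that exceeds them and half the diameter, but a translate of \<open>K\<close> fits into the \<open>l\<close>-fold hexagon.
\<close>

theorem inradius_ge_third_circumradius:
  assumes K: "convex_body K" and less: "gauge_diameter K H < 2 * circumradius K H"
  shows "circumradius K H / 3 \<le> inradius K H"
proof -
  have K': "compact K" "K \<noteq> {}" using K by (auto simp: convex_body_def)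
  have extrema: "\<exists>p\<in>K. \<exists>q\<in>K. \<forall>x\<in>K. f q \<le> f x \<and> f x \<le> f p" if "linear f" for f :: "'a \<Rightarrow> real"
  proof -
    have "continuous_on K f" using that 
      by (intro linear_continuous_on) (simp add: linear_conv_bounded_linear)
    thus ?thesis using continuous_attains_sup[OF K'] continuous_attains_inf[OF K'] by metis
  qed
  obtain p1 q1 where 1: "p1 \<in> K" "q1 \<in> K" "\<And>x. x \<in> K \<Longrightarrow> f1 q1 \<le> f1 x \<and> f1 x \<le> f1 p1"
    using extrema[OF linear(1)] by blast
  obtain p2 q2 where 2: "p2 \<in> K" "q2 \<in> K" "\<And>x. x \<in> K \<Longrightarrow> f2 q2 \<le> f2 x \<and> f2 x \<le> f2 p2"
    using extrema[OF linear(2)] by blast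
  obtain p3 q3 where 3: "p3 \<in> K" "q3 \<in> K" "\<And>x. x \<in> K \<Longrightarrow> f3 q3 \<le> f3 x \<and> f3 x \<le> f3 p3"
    using extrema[OF linear(3)] by blast
  define R where "R = circumradius K H"
  define D where "D = gauge_diameter K H"
  note width = coordinate_width_le_diameter(1)[OF K'(1) 1(1,2)]
    coordinate_width_le_diameter(2)[OF K'(1) 2(1,2)] coordinate_width_le_diameter(3)[OF K'(1) 3(1,2)]
  have "D \<ge> 0" using coordinate_width_le_diameter(1)[OF K'(1) 1(1,1)] by (simp add: D_def)
  hence R: "R > 0" "D < 2 * R" using less by (auto simp: R_def D_def)
  define S where "S = (f1 p1 + f2 p2 + f3 p3) / 3"
  define S' where "S' = - (f1 q1 + f2 q2 + f3 q3) / 3"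
  have "R \<le> S \<or> R \<le> S'"
  proof (rule ccontr)
    assume "\<not> ?thesis"
    then obtain l where l: "max (D / 2) (max S (max S' 0)) < l" "l < R"
      using R dense[of "max (D / 2) (max S (max S' 0))" R] by auto
    have "circumradius K H \<le> l"
      by (rule circumradius_le[OF K' _ 1(3) 2(3) 3(3)])
        (use l width in \<open>auto simp: S_def S'_def D_def\<close>)
    thus False using l by (simp add: R_def)
  qed
  thus ?thesis
  proof
    assume S: "R \<le> S"
    have "S / 3 \<le> inradius K H"
      by (rule inradius_ge_third_maxima[OF K _ _ 1(1) 2(1) 3(1)])
        (use S R in \<open>auto simp: S_def D_def\<close>)
    thus ?thesis using S by (simp add: R_def)
  next
    assume S: "R \<le> S'"
    interpret opp: hexagonal_gauge "\<lambda>x. - f1 x" "\<lambda>x. - f2 x" "\<lambda>x. - f3 x" c H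
      by (rule opposite)
    have "S' / 3 \<le> inradius K H"
      by (rule opp.inradius_ge_third_maxima[OF K _ _ 1(2) 2(2) 3(2)])
        (use S R in \<open>auto simp: S'_def D_def\<close>)
    thus ?thesis using S by (simp add: R_def)
  qed
qed

end

section \<open>Regular hexagons\<close>

text \<open>
  The vector from the centre to a vertex is the sum of the vectors to the two neighbouring
  vertices, so two consecutive ones determine all six.
\<close>

lemma regular_hexagon_vertices:
  assumes "regular_hexagon H"
  obtains c u v :: "real^2" where "u $ 1 * v $ 2 - u $ 2 * v $ 1 \<noteq> 0"
    "H = convex hull {c + u, c + v, c - (u - v), c - u, c - v, c + (u - v)}"
proof -
  obtain c \<rho> \<theta> where \<rho>: "0 < \<rho>" and H: "H = convex hull ((\<lambda>k::nat. c + \<rho> *\<^sub>R vector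
      [cos (\<theta> + 2 * pi * real k / 6), sin (\<theta> + 2 * pi * real k / 6)]) ` {..<6})"
    using assms unfolding regular_hexagon_def by blast
  define P :: "real \<Rightarrow> real^2" where "P = (\<lambda>\<phi>. \<rho> *\<^sub>R vector [cos \<phi>, sin \<phi>])"
  define u where "u = P \<theta>"
  define v where "v = P (\<theta> + pi / 3)"
  have antipode: "P (\<phi> + pi) = - P \<phi>" for \<phi>
    by (simp add: P_def vec_eq_iff forall_2)
  have third: "P (\<theta> + 2 * pi / 3) = v - u"
  proof -
    have "cos (2 * pi / 3) = - 1 / 2" "sin (2 * pi / 3) = sqrt 3 / 2"
      using cos_double_cos[of "pi / 3"] sin_double[of "pi / 3"]
      by (simp_all add: cos_60 sin_60 power2_eq_square)
    thus ?thesis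
      by (simp add: P_def u_def v_def vec_eq_iff forall_2 cos_add sin_add cos_60 sin_60
          algebra_simps)
  qed
  have six: "{..<6::nat} = {0, 1, 2, 3, 4, 5}" by auto
  have "P (\<theta> + 2 * pi * real 0 / 6) = u" by (simp add: u_def)
  moreover have "P (\<theta> + 2 * pi * real 1 / 6) = v" by (simp add: v_def)
  moreover have "P (\<theta> + 2 * pi * real 2 / 6) = - (u - v)" using third by (simp add: field_simps)
  moreover have "P (\<theta> + 2 * pi * real 3 / 6) = - u" using antipode[of \<theta>] by (simp add: u_def)
  moreover have "P (\<theta> + 2 * pi * real 4 / 6) = - v"
    using antipode[of "\<theta> + pi / 3"] by (simp add: v_def field_simps)
  moreover have "P (\<theta> + 2 * pi * real 5 / 6) = u - v"
    using antipode[of "\<theta> + 2 * pi / 3"] third by (simp add: field_simps)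
  ultimately have "(\<lambda>k::nat. c + P (\<theta> + 2 * pi * real k / 6)) ` {..<6}
      = {c + u, c + v, c - (u - v), c - u, c - v, c + (u - v)}"
    unfolding six image_insert image_empty by (simp only: diff_conv_add_uminus)
  moreover have "u $ 1 * v $ 2 - u $ 2 * v $ 1 \<noteq> 0"
  proof -
    have "u $ 1 * v $ 2 - u $ 2 * v $ 1 
        = \<rho> * \<rho> * (cos \<theta> * cos \<theta> + sin \<theta> * sin \<theta>) * sin (pi / 3)"
      by (simp add: u_def v_def P_def cos_add sin_add algebra_simps del: sin_cos_squared_add3)
    also have "\<dots> > 0" using \<rho> by (simp add: sin_60)
    finally show ?thesis by simp
  qed
  ultimately show ?thesis using that H by (simp add: P_def)
qed

lemma regular_hexagon_hexagonal_gauge: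
  assumes "regular_hexagon H"
  obtains f1 f2 f3 c where "hexagonal_gauge f1 f2 f3 c H"
proof -
  obtain c u v where det: "u $ 1 * v $ 2 - u $ 2 * v $ 1 \<noteq> 0" (is "?d \<noteq> 0")
    and H: "H = convex hull {c + u, c + v, c - (u - v), c - u, c - v, c + (u - v)}" (is "_ = convex hull ?V")
    by (rule regular_hexagon_vertices[OF assms])
  \<comment> \<open>The coordinates with respect to the basis \<open>u\<close>, \<open>v\<close>, by Cramer's rule.\<close>
  define f1 where "f1 = (\<lambda>x::real^2. (x $ 1 * v $ 2 - x $ 2 * v $ 1) / ?d)"
  define f2 where "f2 = (\<lambda>x::real^2. (u $ 1 * x $ 2 - u $ 2 * x $ 1) / ?d)"
  define f3 where "f3 = (\<lambda>x. - f1 x - f2 x)"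
  have linear: "linear f1" "linear f2" "linear f3"
    by (auto intro!: linearI simp: f1_def f2_def f3_def add_divide_distrib diff_divide_distrib algebra_simps)
  have coords: "f1 (a *\<^sub>R u + b *\<^sub>R v) = a" "f2 (a *\<^sub>R u + b *\<^sub>R v) = b" for a b
    using det by (simp_all add: f1_def f2_def field_simps)
  have expand: "x = f1 x *\<^sub>R u + f2 x *\<^sub>R v" for x
  proof -
    have "?d *\<^sub>R x = (?d * f1 x) *\<^sub>R u + (?d * f2 x) *\<^sub>R v"
      using det by (simp add: vec_eq_iff forall_2 f1_def f2_def) (simp add: algebra_simps)
    hence "?d *\<^sub>R x = ?d *\<^sub>R (f1 x *\<^sub>R u + f2 x *\<^sub>R v)" by (simp add: scaleR_add_right)
    thus ?thesis using det by (simp only: scaleR_left_imp_eq[OF det])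
  qed
  let ?X = "{x. \<bar>f1 (x - c)\<bar> \<le> 1 \<and> \<bar>f2 (x - c)\<bar> \<le> 1 \<and> \<bar>f3 (x - c)\<bar> \<le> 1}"
  have "H = ?X"
  proof
    have strip: "convex {x. \<bar>f (x - c)\<bar> \<le> 1}" if "linear f" for f :: "real^2 \<Rightarrow> real"
    proof -
      have "{x. \<bar>f (x - c)\<bar> \<le> 1} = (+) c ` (f -` {-1..1})"
        by (auto simp: abs_le_iff image_iff intro!: bexI[of _ "_ - c"])
      thus ?thesis using that by (simp add: convex_translation convex_linear_vimage)
    qed
    have "convex ({x. \<bar>f1 (x - c)\<bar> \<le> 1} \<inter> {x. \<bar>f2 (x - c)\<bar> \<le> 1} \<inter> {x. \<bar>f3 (x - c)\<bar> \<le> 1})"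
      by (intro convex_Int strip linear)
    hence "convex ?X" by (simp add: Int_def conj_assoc)
    moreover have "?V \<subseteq> ?X"
      using coords[of 1 0] coords[of 0 1] coords[of "-1" 1] coords[of "-1" 0] coords[of 0 "-1"] coords[of 1 "-1"]
      by (simp add: f3_def)
    ultimately show "H \<subseteq> ?X" unfolding H by (rule hull_minimal[rotated])
  next
    have V: "?V \<subseteq> H" unfolding H by (rule hull_subset)
    show "?X \<subseteq> H"
    proof
      fix x assume "x \<in> ?X"
      hence "c + (f1 (x - c) *\<^sub>R u + f2 (x - c) *\<^sub>R v) \<in> H"
        using V by (intro hexagon_subset_convex) (auto simp: H f3_def abs_le_iff)
      thus "x \<in> H" using expand[of "x - c"] by simp
    qed
  qed
  hence mem_iff: "x \<in> H \<longleftrightarrow> \<bar>f1 (x - c)\<bar> \<le> 1 \<and> \<bar>f2 (x - c)\<bar> \<le> 1 \<and> \<bar>f3 (x - c)\<bar> \<le> 1" for x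
    by blast
  have body: "convex_body H"
    unfolding convex_body_def H by (simp add: compact_convex_hull finite_imp_compact)
  have "hexagonal_gauge f1 f2 f3 c H"
  proof (intro hexagonal_gauge.intro linear body mem_iff)
    show "x = y" if "f1 x = f1 y" "f2 x = f2 y" for x y
      using expand[of x] expand[of y] that by simp
    show "\<exists>x. f1 x = s \<and> f2 x = t" for s t
      using coords by blast
    show "f1 x + f2 x + f3 x = 0" for x
      by (simp add: f3_def)
  qed
  thus ?thesis by (rule that)
qed

section \<open>The inradius for a regular hexagon\<close>

theorem theorem1p4:
  fixes K H :: "(real^2) set"
  assumes "convex_body K"
    and "regular_hexagon H"
    and "gauge_diameter K H < 2 * circumradius K H"
  shows "inradius K H \<ge> circumradius K H / 4"
proof -
  obtain f1 f2 f3 c where "hexagonal_gauge f1 f2 f3 c H"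
    by (rule regular_hexagon_hexagonal_gauge[OF assms(2)])
  then interpret hexagonal_gauge f1 f2 f3 c H .
  have "0 \<le> circumradius K H"
    using assms(1) body interior_nonempty
    by (intro circumradius_least(1)) (auto simp: convex_body_def)
  thus ?thesis using inradius_ge_third_circumradius[OF assms(1,3)] by linarith
qed

end
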